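(* Let $d, n\ge 1$ be integers, let $H$ be a non-empty hypergraph on vertex set $[n]$ (not necessarily inclusion-free), and for each $w\in[d]^n$ and $e\in H$ let $F_w(e)$ be an element of some fixed totally ordered set. Let $\mathcal{M}_F(w)=\{e\in H: F_w(e)\le F_w(h)\text{ for all }h\in H\}$. Suppose that for every $w\in[d]^n$ the following two properties hold: (A) $\mathcal{M}_F(w)$ is an antichain; (B) for every private pair $(e,S)$ of $\mathcal{M}_F(w)$ with $w-\chi_S\in[d]^n$, we have $\mathcal{M}_F(w-\chi_S)=\{e\}$. Let $Z(H,d,F)=\{w\in[d]^n: |\mathcal{M}_F(w)|=1\}$ and let $Z_1(H,d,F)$ be the set of $w\in Z(H,d,F)$ with $\min_{i\in[n]} w(i)=1$. Then $$|Z_1(H,d,F)|\ge n(d-1)^{n-1}\qquad\text{and}\qquad |Z(H,d,F)|\ge n\sum_{j=0}^{d-1} j^{n-1}.$$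
   Context: For a positive integer $m$, $[m]=\{1,\ldots,m\}$. A hypergraph on vertex set $[n]$ is a set of subsets of $[n]$, called edges; it is inclusion-free if no edge is a proper subset of another edge. Elements $w\in[d]^n$ are functions $w:[n]\to[d]$. For $S\subseteq[n]$, $\chi_S:[n]\to\{0,1\}$ is the indicator function of $S$, and $w-\chi_S$ is the pointwise difference. An antichain is a family of sets, none of which is a proper subset of another. For an antichain $\mathcal{A}$, a pair $(A,S)$ is a private pair of $\mathcal{A}$ if $A\in\mathcal{A}$, $S\subseteq A$, and $S\nsubseteq B$ for every $B\in\mathcal{A}\setminus\{A\}$. The convention $0^0=1$ is used. *)

theory Defs
  imports Complex_Main "HOL-Library.FuncSet" "HOL-Library.Indicator_Function"
begin

definition hypergraph_on :: "'v set \<Rightarrow> 'v set set \<Rightarrow> bool" where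
  "hypergraph_on V H \<longleftrightarrow> (\<forall>e\<in>H. e \<subseteq> V)"

definition antichain :: "'v set set \<Rightarrow> bool" where
  "antichain \<A> \<longleftrightarrow> (\<forall>A\<in>\<A>. \<forall>B\<in>\<A>. \<not> A \<subset> B)"

definition private_pair :: "'v set set \<Rightarrow> 'v set \<Rightarrow> 'v set \<Rightarrow> bool" where
  "private_pair \<A> A S \<longleftrightarrow> A \<in> \<A> \<and> S \<subseteq> A \<and> (\<forall>B\<in>\<A> - {A}. \<not> S \<subseteq> B)"

(* The functions from [n] to [d]; they take the value undefined outside [n]. *)
definition words :: "nat \<Rightarrow> nat \<Rightarrow> (nat \<Rightarrow> nat) set" where
  "words d n = {1..n} \<rightarrow>\<^sub>E {1..d}"

(* w - \<chi>_S for S a subset of [n]. Truncated subtraction never differs from the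
   integer one here, since w(i) >= 1 on [n] for every w in words d n. *)
definition minus_chi :: "nat \<Rightarrow> (nat \<Rightarrow> nat) \<Rightarrow> nat set \<Rightarrow> nat \<Rightarrow> nat" where
  "minus_chi n w S = (\<lambda>i\<in>{1..n}. w i - indicator S i)"

definition minimizers ::
  "nat set set \<Rightarrow> ((nat \<Rightarrow> nat) \<Rightarrow> nat set \<Rightarrow> 'b::linorder) \<Rightarrow> (nat \<Rightarrow> nat) \<Rightarrow> nat set set" where
  "minimizers H F w = {e \<in> H. \<forall>h\<in>H. F w e \<le> F w h}"

definition Z_set ::
  "nat \<Rightarrow> nat set set \<Rightarrow> nat \<Rightarrow> ((nat \<Rightarrow> nat) \<Rightarrow> nat set \<Rightarrow> 'b::linorder) \<Rightarrow> (nat \<Rightarrow> nat) set" where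
  "Z_set n H d F = {w \<in> words d n. card (minimizers H F w) = 1}"

definition Z1_set ::
  "nat \<Rightarrow> nat set set \<Rightarrow> nat \<Rightarrow> ((nat \<Rightarrow> nat) \<Rightarrow> nat set \<Rightarrow> 'b::linorder) \<Rightarrow> (nat \<Rightarrow> nat) set" where
  "Z1_set n H d F = {w \<in> Z_set n H d F. Min (w ` {1..n}) = 1}"

end

theory Submission
  imports Defs
begin

text \<open>
  Charge every word v with exactly one coordinate equal to 1, say coordinate i, to isolated words
  (one minimizer, some coordinate 1); there are n * (d - 1) ^ (n - 1) such v.

  If some minimizer e of v avoids i, then e itself is private, and v minus the indicator of e is
  isolated; it is the only kind of image whose set of ones is not contained in its minimizer, and
  v can be recovered from it.

  Otherwise every minimizer e contains i, so e minus i is private. Let S be a private subset of it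
  of least size. Each x in S has a minimizer f with S - f = {x}, so v has more than card S minimizers,
  and the weights 1 / (card S + 1), one for each e, add up to at least 1. For fixed i and e, a
  coordinatewise shifting argument bounds the number of these v with card S + 1 at most a by the
  number of isolated words with minimizer e, a 1 at i, and at most a ones, all of them inside e.
  Hence the weights for i and e add up to at most the sum of 1 / (number of ones) over such words,
  and summing over i charges every isolated word at most once.

  The second bound adds up the first one over the boxes {m..d}, since the words with
  minimum m correspond to the words with minimum 1 of a box with side d - m + 1.
\<close>

section \<open>Two counting inequalities\<close>

text \<open>By Abel summation, on values up to \<open>N\<close> the function \<open>h\<close> is the
  constant \<open>h N\<close> plus a nonnegative combination of indicators of a <= s. Each indicator
  sums to a threshold count, so the two sums compare term by term.\<close>

lemma sum_antimono_le_of_card_le: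
  fixes h :: "nat \<Rightarrow> real"
  assumes "finite X" "finite Y" and h: "antimono h" "\<And>a. 0 \<le> h a"
    and le: "\<And>a. card {x \<in> X. f x \<le> a} \<le> card {y \<in> Y. g y \<le> a}"
  shows "(\<Sum>x\<in>X. h (f x)) \<le> (\<Sum>y\<in>Y. h (g y))"
proof -
  define N where "N = Max (insert 0 (f ` X \<union> g ` Y))"
  have fN: "f x \<le> N" if "x \<in> X" for x
    unfolding N_def using that assms by (intro Max_ge) auto
  have gN: "g y \<le> N" if "y \<in> Y" for y
    unfolding N_def using that assms by (intro Max_ge) auto
  have layers: "h a = h N + (\<Sum>s<N. (h s - h (Suc s)) * (if a \<le> s then 1 else 0))" if "a \<le> N" for a
  proof -
    have "(\<Sum>s<N. (h s - h (Suc s)) * (if a \<le> s then 1 else 0)) = (\<Sum>s=a..<N. h s - h (Suc s))"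
      by (rule sum.mono_neutral_cong_right) auto
    also have "\<dots> = h a - h N"
      using sum_Suc_diff'[OF that, of "\<lambda>s. - h s"] by simp
    finally show ?thesis by simp
  qed
  have total: "(\<Sum>z\<in>W. h (q z)) =
      h N * real (card W) + (\<Sum>s<N. (h s - h (Suc s)) * real (card {z \<in> W. q z \<le> s}))"
    if "finite W" "\<And>z. z \<in> W \<Longrightarrow> q z \<le> N" for W :: "'z set" and q
  proof -
    have "(\<Sum>z\<in>W. h (q z)) =
        (\<Sum>z\<in>W. h N + (\<Sum>s<N. (h s - h (Suc s)) * (if q z \<le> s then 1 else 0)))"
      by (rule sum.cong[OF refl], rule layers, erule that(2))
    also have "\<dots> = h N * real (card W) +
        (\<Sum>s<N. \<Sum>z\<in>W. (h s - h (Suc s)) * (if q z \<le> s then 1 else 0))"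
      by (subst sum.swap) (simp add: sum.distrib)
    also have "\<dots> = h N * real (card W) + (\<Sum>s<N. (h s - h (Suc s)) * real (card {z \<in> W. q z \<le> s}))"
      using that(1) by (simp add: sum_distrib_left[symmetric] sum.If_cases Int_def)
    finally show ?thesis .
  qed
  have "card X \<le> card Y"
  proof -
    have "{x \<in> X. f x \<le> N} = X" "{y \<in> Y. g y \<le> N} = Y" using fN gN by auto
    with le[of N] show ?thesis by simp
  qed
  moreover have "h (Suc s) \<le> h s" for s
    using h(1) by (auto simp: antimono_def)
  ultimately show ?thesis
    by (subst (1 2) total) (use assms(1,2) fN gN h(2) le in
      \<open>auto intro!: add_mono mult_left_mono sum_mono\<close>)
qed

text \<open>For x in \<open>S\<close>, another member \<open>f x\<close> contains
  \<open>S - {x}\<close> and misses x because \<open>S\<close> is private. So x is the only element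
  of \<open>S\<close> outside \<open>f x\<close>, which makes \<open>f\<close> injective into the
  members other than \<open>e\<close>.\<close>

lemma card_private_less:
  assumes "finite \<A>" and S: "private_pair \<A> e S" "finite S"
    and min: "\<And>x. x \<in> S \<Longrightarrow> \<not> private_pair \<A> e (S - {x})"
  shows "card S < card \<A>"
proof -
  have "\<exists>B\<in>\<A> - {e}. S - {x} \<subseteq> B" if "x \<in> S" for x
    using min[OF that] S by (auto simp: private_pair_def)
  then obtain f where f: "\<And>x. x \<in> S \<Longrightarrow> f x \<in> \<A> - {e} \<and> S - {x} \<subseteq> f x"
    by metis
  have notin: "x \<notin> f x" if "x \<in> S" for x
    using f[OF that] S that by (auto simp: private_pair_def)
  have "inj_on f S"
    by (rule inj_onI) (metis Diff_iff f notin singletonD subsetD)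
  then have "card S \<le> card (\<A> - {e})"
    using f assms(1) by (intro card_inj_on_le[of f]) auto
  also have "\<dots> < card \<A>"
    using S assms(1) by (intro psubset_card_mono) (auto simp: private_pair_def)
  finally show ?thesis .
qed

section \<open>Words and their ones\<close>

lemma words_eqI:
  assumes "x \<in> words d n" "y \<in> words d n" "\<And>j. j \<in> {1..n} \<Longrightarrow> x j = y j"
  shows "x = y"
  using assms unfolding words_def by (rule PiE_ext)

lemma words_upd:
  assumes "x \<in> words d n" "k \<in> {1..n}" "1 \<le> c" "c \<le> d"
  shows "x(k := c) \<in> words d n"
  using assms unfolding words_def by (auto simp: PiE_iff extensional_def)

lemma words_bounds:
  assumes "x \<in> words d n" "j \<in> {1..n}"
  shows "1 \<le> x j" "x j \<le> d"
  using assms unfolding words_def by (auto simp: PiE_iff)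

lemma finite_words [simp]: "finite (words d n)"
  unfolding words_def by (intro finite_PiE) auto

definition ones :: "nat \<Rightarrow> (nat \<Rightarrow> nat) \<Rightarrow> nat set" where
  "ones n x = {j \<in> {1..n}. x j = 1}"

lemma finite_ones [simp]: "finite (ones n x)"
  by (simp add: ones_def)

section \<open>Coordinatewise shifting\<close>

definition below_on :: "nat \<Rightarrow> nat \<Rightarrow> nat set \<Rightarrow> (nat \<Rightarrow> nat) \<Rightarrow> (nat \<Rightarrow> nat) set" where
  "below_on d n S x =
     {y \<in> words d n. (\<forall>j\<in>S. y j < x j) \<and> (\<forall>j\<in>{1..n} - S. y j = x j)}"

text \<open>
  The set K holds the coordinates not yet processed by the shifting. For K empty these are the words
  in E with at most a ones. A coordinate k in S with value at least 2 may be lowered to 1, which costs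
  one additional 1; therefore card S is added to the number of ones.
\<close>
definition descenders ::
  "nat \<Rightarrow> nat \<Rightarrow> (nat \<Rightarrow> nat) set \<Rightarrow> nat \<Rightarrow> nat set \<Rightarrow> (nat \<Rightarrow> nat) set" where
  "descenders d n E a K =
     {x \<in> words d n. (\<forall>j\<in>K. 2 \<le> x j) \<and>
        (\<exists>S\<subseteq>K. card S + card (ones n x) \<le> a \<and> below_on d n S x \<subseteq> E)}"

text \<open>Lowering a word at k may create a one at k; this is paid for by removing k from the
  witness \<open>S\<close> of a point of \<open>T\<close> on its line. An unmoved word has no
  witness containing k, since it would then lie in \<open>T\<close> itself, so its witness
  survives.\<close>

lemma card_descenders_insert:
  assumes "finite K" "k \<notin> K" "k \<in> {1..n}"
  shows "card (descenders d n E a (insert k K)) \<le> card (descenders d n E a K)"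
proof -
  define T where "T = {z \<in> words d n. \<exists>S\<subseteq>K.
      Suc (card S) + card (ones n z) \<le> a \<and> below_on d n (insert k S) z \<subseteq> E}"
  \<comment> \<open>On a line in direction k, every position strictly below a point of T descends without using k.
    So moving all points up to the topmost point of T down by one is injective.\<close>
  define moved where "moved x \<longleftrightarrow> (\<exists>c\<ge>x k. x(k := c) \<in> T)" for x :: "nat \<Rightarrow> nat"
  define f where "f x = (if moved x then x(k := x k - 1) else x)" for x :: "nat \<Rightarrow> nat"
  have k2: "2 \<le> x k" "x \<in> words d n" if "x \<in> descenders d n E a (insert k K)" for x
    using that by (auto simp: descenders_def)
  have "inj_on f (descenders d n E a (insert k K))"
  proof (rule inj_onI)
    \<comment> \<open>The word \<open>x'\<close> is one step below \<open>x\<close> on the same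
      line, so the point of \<open>T\<close> that makes \<open>x\<close> moved makes
      \<open>x'\<close> moved as well.\<close>
    have aux: False if x: "2 \<le> x k" and "moved x" "\<not> moved x'" "x(k := x k - 1) = x'" for x x'
    proof -
      obtain c where c: "c \<ge> x k" "x(k := c) \<in> T" using \<open>moved x\<close> moved_def by auto
      have "x'(k := c) = x(k := c)" "x' k \<le> c" using that c by auto
      with c \<open>\<not> moved x'\<close> show False unfolding moved_def by metis
    qed
    fix x x' assume x: "x \<in> descenders d n E a (insert k K)" and x': "x' \<in> descenders d n E a (insert k K)"
      and eq: "f x = f x'"
    show "x = x'"
    proof (cases "moved x = moved x'")
      case True
      show ?thesis
      proof (cases "moved x")
        case m: True
        have e: "x(k := x k - 1) = x'(k := x' k - 1)" using eq True m by (simp add: f_def)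
        have "x j = x' j" for j
        proof (cases "j = k")
          case True
          have "x k - 1 = x' k - 1" using fun_cong[OF e, of k] by simp
          then show ?thesis using k2(1)[OF x] k2(1)[OF x'] True by simp
        next
          case False
          then show ?thesis using fun_cong[OF e, of j] by simp
        qed
        then show ?thesis by auto
      next
        case False
        then show ?thesis using eq True by (simp add: f_def)
      qed
    next
      case False
      then show ?thesis
        using aux[of x x'] aux[of x' x] k2(1)[OF x] k2(1)[OF x'] eq unfolding f_def by metis
    qed
  qed
  moreover have "f x \<in> descenders d n E a K" if x: "x \<in> descenders d n E a (insert k K)" for x
  proof (cases "moved x")
    case True
    then obtain c S where c: "c \<ge> x k" "x(k := c) \<in> words d n" and S: "S \<subseteq> K"
      "Suc (card S) + card (ones n (x(k := c))) \<le> a" "below_on d n (insert k S) (x(k := c)) \<subseteq> E"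
      unfolding moved_def T_def by auto
    define y where "y = x(k := x k - 1)"
    have w: "y \<in> words d n"
      unfolding y_def using k2[OF x] words_bounds(2)[of x d n k] assms(3) by (intro words_upd) auto
    have "ones n y \<subseteq> insert k (ones n (x(k := c)))"
      by (auto simp: ones_def y_def)
    then have "card (ones n y) \<le> Suc (card (ones n (x(k := c))))"
      using card_mono[of "insert k (ones n (x(k := c)))" "ones n y"] by (simp add: card_insert_if split: if_splits)
    \<comment> \<open>A word in the left set has the entry x k - 1 < c at k, so the strict drop
      required in direction k is automatic.\<close>
    moreover have "below_on d n S y \<subseteq> below_on d n (insert k S) (x(k := c))"
    proof
      fix u assume u: "u \<in> below_on d n S y"
      have "k \<notin> S" using S(1) assms(2) by auto
      moreover have "u k = x k - 1" using u \<open>k \<notin> S\<close> assms(3) by (auto simp: below_on_def y_def)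
      ultimately show "u \<in> below_on d n (insert k S) (x(k := c))"
        using u c(1) k2(1)[OF x] by (auto simp: below_on_def y_def)
    qed
    moreover have "\<forall>j\<in>K. 2 \<le> y j"
      using x assms(2) by (auto simp: descenders_def y_def)
    ultimately have "y \<in> descenders d n E a K"
      unfolding descenders_def using w S by (auto intro!: exI[of _ S])
    then show ?thesis using True by (simp add: f_def y_def)
  next
    case False
    obtain S where S: "S \<subseteq> insert k K" "card S + card (ones n x) \<le> a" "below_on d n S x \<subseteq> E"
      using x by (auto simp: descenders_def)
    have "k \<notin> S"
    proof
      assume "k \<in> S"
      have "finite S" using S(1) assms(1) finite_subset by blast
      then have "Suc (card (S - {k})) = card S" "insert k (S - {k}) = S"
        using \<open>k \<in> S\<close> by (auto simp: card_Suc_Diff1 simp del: card_Diff_insert)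
      then have "x \<in> T" unfolding T_def using S k2(2)[OF x]
        by (auto intro!: exI[of _ "S - {k}"])
      then have "moved x" unfolding moved_def by (intro exI[of _ "x k"]) auto
      with False show False by simp
    qed
    then have "S \<subseteq> K" using S(1) by auto
    then show ?thesis using False x S by (auto simp: descenders_def f_def)
  qed
  moreover have "finite (descenders d n E a K)" by (simp add: descenders_def)
  ultimately show ?thesis by (intro card_inj_on_le[of f]) auto
qed

lemma card_descenders_le:
  assumes "finite K" "K \<subseteq> {1..n}"
  shows "card (descenders d n E a K) \<le> card {x \<in> words d n \<inter> E. card (ones n x) \<le> a}"
  using assms
proof (induction K)
  case empty
  have "descenders d n E a {} \<subseteq> {x \<in> words d n \<inter> E. card (ones n x) \<le> a}"
    by (auto simp: descenders_def below_on_def)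
  then show ?case by (intro card_mono) auto
next
  case (insert k K)
  then show ?case using card_descenders_insert[of K k n d E a] by auto
qed

section \<open>Descent along private pairs\<close>

text \<open>\<open>M\<close> stands for \<open>minimizers H F\<close>. Of the ordering behind it
  only non-emptiness and the properties (A) and (B) are kept.\<close>

locale private_descent =
  fixes d n :: nat and M :: "(nat \<Rightarrow> nat) \<Rightarrow> nat set set"
  assumes d: "1 \<le> d" and n: "1 \<le> n"
    and M_sub: "w \<in> words d n \<Longrightarrow> M w \<subseteq> Pow {1..n}"
    and M_ne: "w \<in> words d n \<Longrightarrow> M w \<noteq> {}"
    and M_antichain: "w \<in> words d n \<Longrightarrow> antichain (M w)"
    and M_private: "w \<in> words d n \<Longrightarrow> private_pair (M w) e S \<Longrightarrow>
      minus_chi n w S \<in> words d n \<Longrightarrow> M (minus_chi n w S) = {e}"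
begin

lemma finite_M: "w \<in> words d n \<Longrightarrow> finite (M w)"
  using M_sub finite_subset by blast

lemma minus_chi_words:
  assumes "w \<in> words d n" "\<And>j. j \<in> S \<Longrightarrow> j \<in> {1..n} \<Longrightarrow> 2 \<le> w j"
  shows "minus_chi n w S \<in> words d n"
proof -
  have "w j - indicator S j \<in> {1..d}" if "j \<in> {1..n}" for j
    using words_bounds[OF assms(1) that] assms(2)[of j] that by (cases "j \<in> S") auto
  then show ?thesis by (auto simp: words_def minus_chi_def)
qed

text \<open>When \<open>e\<close> is the only minimizer, each of its subsets is private. Hence (B)
  can be applied repeatedly, lowering by 1 all coordinates still above \<open>x\<close>, until
  \<open>x\<close> is reached.\<close>

lemma M_below_isolated:
  assumes "w \<in> words d n" "M w = {e}" "x \<in> words d n"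
    "\<And>j. j \<in> {1..n} \<Longrightarrow> x j \<le> w j" "\<And>j. j \<in> {1..n} \<Longrightarrow> x j < w j \<Longrightarrow> j \<in> e"
  shows "M x = {e}"
  using assms
proof (induction "\<Sum>j\<in>{1..n}. w j" arbitrary: w rule: less_induct)
  case less
  define R where "R = {j \<in> {1..n}. x j < w j}"
  define w' where "w' = minus_chi n w R"
  have w': "w' j = (if j \<in> R then w j - 1 else w j)" if "j \<in> {1..n}" for j
    using that by (simp add: w'_def minus_chi_def)
  show ?case
  proof (cases "R = {}")
    case True
    then have "x j = w j" if "j \<in> {1..n}" for j
      using less.prems(4)[OF that] that unfolding R_def by force
    then show ?thesis using words_eqI less.prems by metis
  next
    case False
    then obtain k where k: "k \<in> R" by auto
    have ge2: "2 \<le> w j" if "j \<in> R" for j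
      using that words_bounds(1)[OF less.prems(3)] unfolding R_def by force
    have w'w: "w' \<in> words d n" unfolding w'_def using less.prems(1) ge2 by (rule minus_chi_words)
    have "private_pair (M w) e R"
      using less.prems by (auto simp: private_pair_def R_def)
    then have "M w' = {e}" using M_private less.prems(1) w'w unfolding w'_def by blast
    moreover have "(\<Sum>j\<in>{1..n}. w' j) < (\<Sum>j\<in>{1..n}. w j)"
      using k ge2[OF k] w' by (intro sum_strict_mono_ex1) (auto simp: R_def intro!: bexI[of _ k])
    moreover have "x j \<le> w' j" if "j \<in> {1..n}" for j
      using less.prems(4)[OF that] w'[OF that] that by (auto simp: R_def)
    moreover have "j \<in> e" if "j \<in> {1..n}" "x j < w' j" for j
      using less.prems(5)[OF that(1)] w'[OF that(1)] that by (auto split: if_splits)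
    ultimately show ?thesis using less.hyps[of w'] w'w less.prems(3) by blast
  qed
qed

text \<open>One use of (B) makes \<open>e\<close> the only minimizer of
  \<open>minus_chi n w S\<close>; the remaining drops all happen inside \<open>S\<close>, hence
  inside \<open>e\<close>, and are covered by \<open>M_below_isolated\<close>.\<close>

lemma M_below_private:
  assumes w: "w \<in> words d n" and p: "private_pair (M w) e S" and x: "x \<in> below_on d n S w"
  shows "M x = {e}"
proof -
  have S: "S \<subseteq> e" "e \<in> M w" using p by (auto simp: private_pair_def)
  then have "S \<subseteq> {1..n}" using M_sub[OF w] by blast
  have xw: "x \<in> words d n" and lt: "\<And>j. j \<in> S \<Longrightarrow> x j < w j"
    and eq: "\<And>j. j \<in> {1..n} \<Longrightarrow> j \<notin> S \<Longrightarrow> x j = w j"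
    using x by (auto simp: below_on_def)
  have ww: "minus_chi n w S \<in> words d n"
    using w by (rule minus_chi_words) (use lt words_bounds(1)[OF xw] in force)
  have val: "minus_chi n w S j = (if j \<in> S then w j - 1 else w j)" if "j \<in> {1..n}" for j
    using that by (simp add: minus_chi_def)
  show ?thesis
  proof (rule M_below_isolated[OF ww M_private[OF w p ww] xw])
    show "x j \<le> minus_chi n w S j" if "j \<in> {1..n}" for j
      using val[OF that] lt[of j] eq[OF that] by auto
    show "j \<in> e" if "j \<in> {1..n}" "x j < minus_chi n w S j" for j
      using val[OF that(1)] eq[OF that(1)] that(2) S(1) by (auto split: if_splits)
  qed
qed

section \<open>Words with a single one, and isolated words\<close>

definition facet :: "nat \<Rightarrow> (nat \<Rightarrow> nat) set" where
  "facet i = {v \<in> words d n. v i = 1 \<and> (\<forall>j\<in>{1..n} - {i}. 2 \<le> v j)}"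

lemma card_facet:
  assumes "i \<in> {1..n}"
  shows "card (facet i) = (d - 1) ^ (n - 1)"
proof -
  define R where "R j = (if j = i then {1} else {2..d})" for j
  have "facet i = PiE {1..n} R"
  proof (intro set_eqI iffI)
    fix v assume v: "v \<in> facet i"
    then have "v j \<in> R j" if "j \<in> {1..n}" for j
      using words_bounds(2)[of v d n j] that by (auto simp: facet_def R_def)
    with v show "v \<in> PiE {1..n} R" by (auto simp: facet_def words_def PiE_iff)
  next
    fix v assume v: "v \<in> PiE {1..n} R"
    then have R: "v j \<in> R j" if "j \<in> {1..n}" for j using that by auto
    have "v j \<in> {1..d}" if "j \<in> {1..n}" for j
      using R[OF that] d by (auto simp: R_def split: if_splits)
    then have "v \<in> words d n" using v by (auto simp: words_def PiE_iff)
    moreover have "v i = 1" using R[OF assms] by (simp add: R_def)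
    moreover have "2 \<le> v j" if "j \<in> {1..n} - {i}" for j
      using R[of j] that by (auto simp: R_def)
    ultimately show "v \<in> facet i" by (simp add: facet_def)
  qed
  then have "card (facet i) = (\<Prod>j\<in>{1..n}. card (R j))" by (simp add: card_PiE)
  also have "\<dots> = card (R i) * (\<Prod>j\<in>{1..n} - {i}. card (R j))"
    using assms by (intro prod.remove) auto
  also have "(\<Prod>j\<in>{1..n} - {i}. card (R j)) = (\<Prod>j\<in>{1..n} - {i}. d - 1)"
    by (intro prod.cong) (auto simp: R_def)
  finally show ?thesis using assms by (simp add: R_def)
qed

text \<open>The locale's version of \<open>Z1_set\<close>: for a word, having minimum 1 amounts to
  having a one.\<close>

definition isolated :: "(nat \<Rightarrow> nat) set" where
  "isolated = {v \<in> words d n. card (M v) = 1 \<and> ones n v \<noteq> {}}"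

definition contained :: "(nat \<Rightarrow> nat) set" where
  "contained = {v \<in> isolated. \<forall>e\<in>M v. ones n v \<subseteq> e}"

lemma finite_isolated: "finite isolated"
  by (simp add: isolated_def)

section \<open>Words with a minimizer that avoids the one\<close>

text \<open>The pair (i, v) can be read off from its image: the unique minimizer of the image is
  \<open>c i v\<close>, the only one of the image outside it is at i, and raising the entries on
  \<open>c i v\<close> by 1 gives v back.\<close>

lemma card_avoiding:
  "(\<Sum>i\<in>{1..n}. card {v \<in> facet i. \<exists>e\<in>M v. i \<notin> e}) \<le> card (isolated - contained)"
proof -
  define A where "A i = {v \<in> facet i. \<exists>e\<in>M v. i \<notin> e}" for i
  define c where "c i v = (SOME e. e \<in> M v \<and> i \<notin> e)" for i v
  define g where "g = (\<lambda>(i, v). minus_chi n v (c i v))"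
  have c: "c i v \<in> M v" "i \<notin> c i v" if "v \<in> A i" for i v
    using that someI_ex[of "\<lambda>e. e \<in> M v \<and> i \<notin> e"] unfolding c_def A_def by blast+
  have A: "v \<in> words d n" "v i = 1" "\<And>j. j \<in> {1..n} \<Longrightarrow> j \<noteq> i \<Longrightarrow> 2 \<le> v j" if "v \<in> A i" for i v
    using that by (auto simp: A_def facet_def)
  have val: "g (i, v) j = (if j \<in> c i v then v j - 1 else v j)" if "j \<in> {1..n}" for i v j
    using that by (simp add: g_def minus_chi_def)
  have gw: "g (i, v) \<in> words d n" if v: "v \<in> A i" for i v
    unfolding g_def prod.case
    by (rule minus_chi_words[OF A(1)[OF v]], rule A(3)[OF v]) (use c(2)[OF v] in auto)
  have Mg: "M (g (i, v)) = {c i v}" if v: "v \<in> A i" for i v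
  proof -
    \<comment> \<open>In an antichain no other member contains a given member.\<close>
    have "private_pair (M v) (c i v) (c i v)"
      using c[OF v] M_antichain[OF A(1)[OF v]] by (auto simp: private_pair_def antichain_def)
    then show ?thesis using M_private[OF A(1)[OF v]] gw[OF v] by (simp add: g_def)
  qed
  have on: "ones n (g (i, v)) - c i v = {i}" if v: "v \<in> A i" "i \<in> {1..n}" for i v
  proof -
    have "j \<in> ones n (g (i, v)) - c i v \<longleftrightarrow> j = i" for j
    proof (cases "j \<in> {1..n}")
      case True
      then show ?thesis using val[OF True, of i v] A[OF v(1)] c[OF v(1)] v(2)
        by (force simp: ones_def)
    qed (use v in \<open>auto simp: ones_def\<close>)
    then show ?thesis by auto
  qed
  have "inj_on g (SIGMA i:{1..n}. A i)"
  proof (rule inj_onI, clarify)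
    fix i v i' v' assume *: "i \<in> {1..n}" "v \<in> A i" "i' \<in> {1..n}" "v' \<in> A i'" "g (i, v) = g (i', v')"
    have e: "c i v = c i' v'" using Mg[OF *(2)] Mg[OF *(4)] *(5) by simp
    then have i: "i = i'" using on[OF *(2,1)] on[OF *(4,3)] *(5) by simp
    have "v = v'"
    proof (rule words_eqI[OF A(1)[OF *(2)] A(1)[OF *(4)]])
      fix j assume j: "j \<in> {1..n}"
      have "j \<in> c i v \<Longrightarrow> 2 \<le> v j" "j \<in> c i v \<Longrightarrow> 2 \<le> v' j"
        using A(3)[OF *(2) j] A(3)[OF *(4) j] c(2)[OF *(2)] i by auto
      then show "v j = v' j"
        using val[OF j, of i v] val[OF j, of i' v'] *(5) e by (auto split: if_splits)
    qed
    with i show "i = i' \<and> v = v'" by simp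
  qed
  moreover have "g ` (SIGMA i:{1..n}. A i) \<subseteq> isolated - contained"
  proof clarify
    fix i v assume *: "i \<in> {1..n}" "v \<in> A i"
    show "g (i, v) \<in> isolated - contained"
      using on[OF *(2,1)] Mg[OF *(2)] gw[OF *(2)] by (auto simp: isolated_def contained_def)
  qed
  ultimately have "card (SIGMA i:{1..n}. A i) \<le> card (isolated - contained)"
    using finite_isolated by (intro card_inj_on_le) auto
  moreover have "finite (A i)" for i by (simp add: A_def facet_def)
  ultimately show ?thesis by (simp add: card_SigmaI A_def)
qed

section \<open>Words all of whose minimizers contain the one\<close>

text \<open>Sets containing i are excluded because the entry at i is already 1 and cannot be
  lowered. On \<open>covering i\<close> the \<open>LEAST\<close> is attained, \<open>e - {i}\<close>
  being a candidate.\<close>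

definition private_rank :: "nat \<Rightarrow> (nat \<Rightarrow> nat) \<Rightarrow> nat set \<Rightarrow> nat" where
  "private_rank i v e = (LEAST s. \<exists>S\<subseteq>e - {i}. private_pair (M v) e S \<and> card S = s)"

definition covering :: "nat \<Rightarrow> (nat \<Rightarrow> nat) set" where
  "covering i = {v \<in> facet i. \<forall>e\<in>M v. i \<in> e}"

lemma private_rank:
  assumes "v \<in> covering i" "e \<in> M v"
  obtains S where "S \<subseteq> e - {i}" "private_pair (M v) e S" "card S = private_rank i v e"
    "private_rank i v e < card (M v)"
proof -
  let ?P = "\<lambda>s. \<exists>S\<subseteq>e - {i}. private_pair (M v) e S \<and> card S = s"
  have v: "v \<in> words d n" "\<And>e. e \<in> M v \<Longrightarrow> i \<in> e"
    using assms by (auto simp: covering_def facet_def)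
  \<comment> \<open>Every minimizer contains i, so one that contains \<open>e - {i}\<close> contains
    \<open>e\<close> and equals it.\<close>
  have "private_pair (M v) e (e - {i})"
    unfolding private_pair_def using assms(2) M_antichain[OF v(1)] v(2)
    by (fastforce simp: antichain_def)
  then have "?P (private_rank i v e)"
    unfolding private_rank_def by (intro LeastI[of ?P "card (e - {i})"]) auto
  then obtain S where S: "S \<subseteq> e - {i}" "private_pair (M v) e S" "card S = private_rank i v e"
    by auto
  have fin: "finite S"
    using S(1) assms(2) M_sub[OF v(1)] by (meson Diff_subset Pow_iff finite_atLeastAtMost finite_subset subset_iff)
  have "card S < card (M v)"
  proof (rule card_private_less[OF finite_M[OF v(1)] S(2) fin])
    fix x assume "x \<in> S"
    show "\<not> private_pair (M v) e (S - {x})"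
    proof
      assume "private_pair (M v) e (S - {x})"
      then have "?P (card (S - {x}))" using S(1) by (intro exI[of _ "S - {x}"]) auto
      then have "private_rank i v e \<le> card (S - {x})"
        unfolding private_rank_def by (rule Least_le)
      then show False using S(3) card_Diff1_less[OF fin \<open>x \<in> S\<close>] by simp
    qed
  qed
  then show ?thesis using that S by simp
qed

text \<open>The shifting compares the two sides threshold by threshold, and
  \<open>sum_antimono_le_of_card_le\<close> turns these counts into weights.\<close>

lemma sum_private_rank_le:
  assumes "i \<in> {1..n}" "e \<subseteq> {1..n}"
  shows "(\<Sum>v\<in>{v \<in> covering i. e \<in> M v}. 1 / real (Suc (private_rank i v e))) \<le>
    (\<Sum>v\<in>{v \<in> words d n. v i = 1 \<and> M v = {e} \<and> ones n v \<subseteq> e}. 1 / real (card (ones n v)))"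
    (is "sum _ ?X \<le> sum _ ?Y")
proof (cases "i \<in> e")
  case False
  then have "?X = {}" by (auto simp: covering_def)
  then show ?thesis by (simp only: sum.empty) (auto intro!: sum_nonneg)
next
  case True
  \<comment> \<open>The one at i belongs to every word in \<open>?Y\<close>; subtracting it puts
    both sides on the scale of h a = 1 / (a + 1).\<close>
  have le: "card {v \<in> ?X. private_rank i v e \<le> a} \<le> card {v \<in> ?Y. card (ones n v) - 1 \<le> a}" for a
  proof -
    have "{v \<in> ?X. private_rank i v e \<le> a} \<subseteq> descenders d n ?Y (Suc a) (e - {i})"
    proof clarify
      fix v assume v: "v \<in> covering i" "e \<in> M v" "private_rank i v e \<le> a"
      obtain S where S: "S \<subseteq> e - {i}" "private_pair (M v) e S" "card S = private_rank i v e"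
        using private_rank[OF v(1,2)] by metis
      have f: "v \<in> words d n" "v i = 1" "\<And>j. j \<in> {1..n} \<Longrightarrow> j \<noteq> i \<Longrightarrow> 2 \<le> v j"
        using v(1) by (auto simp: covering_def facet_def)
      have "ones n v = {i}" using f assms(1) by (force simp: ones_def)
      moreover have "below_on d n S v \<subseteq> ?Y"
      proof
        fix y assume y: "y \<in> below_on d n S v"
        have "M y = {e}" using M_below_private[OF f(1) S(2) y] .
        moreover have "y i = 1"
        proof -
          have "i \<in> {1..n} - S" using S(1) assms(1) by auto
          then show ?thesis using y f(2) unfolding below_on_def by simp
        qed
        \<comment> \<open>Off \<open>S\<close> the word y agrees with v, whose only one is at i, an
          element of \<open>e\<close>.\<close>
        moreover have "j \<in> e" if "j \<in> ones n y" for j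
        proof (rule ccontr)
          assume "j \<notin> e"
          then have "j \<in> {1..n} - S" "j \<noteq> i" using that S(1) True by (auto simp: ones_def)
          then have "y j = v j" "2 \<le> v j" using y f(3) by (auto simp: below_on_def)
          then show False using that by (simp add: ones_def)
        qed
        ultimately show "y \<in> ?Y" using y by (auto simp: below_on_def)
      qed
      moreover have "\<forall>j\<in>e - {i}. 2 \<le> v j" using f(3) assms(2) by blast
      ultimately show "v \<in> descenders d n ?Y (Suc a) (e - {i})"
        unfolding descenders_def using S f v(3) assms(2) by (auto intro!: exI[of _ S])
    qed
    then have "card {v \<in> ?X. private_rank i v e \<le> a} \<le> card (descenders d n ?Y (Suc a) (e - {i}))"
      by (intro card_mono) (auto simp: descenders_def)
    also have "\<dots> \<le> card {x \<in> words d n \<inter> ?Y. card (ones n x) \<le> Suc a}"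
      using assms(2) finite_subset by (intro card_descenders_le) auto
    also have "{x \<in> words d n \<inter> ?Y. card (ones n x) \<le> Suc a} = {v \<in> ?Y. card (ones n v) - 1 \<le> a}"
      by auto
    finally show ?thesis .
  qed
  have "(\<Sum>v\<in>?X. 1 / real (Suc (private_rank i v e))) \<le> (\<Sum>v\<in>?Y. 1 / real (Suc (card (ones n v) - 1)))"
    by (rule sum_antimono_le_of_card_le[OF _ _ _ _ le, where h = "\<lambda>a. 1 / real (Suc a)"])
      (auto simp: covering_def facet_def antimono_def field_simps)
  also have "\<dots> = (\<Sum>v\<in>?Y. 1 / real (card (ones n v)))"
  proof (rule sum.cong)
    fix v assume "v \<in> ?Y"
    then have "i \<in> ones n v" using assms(1) by (simp add: ones_def)
    then have "card (ones n v) > 0" by (auto simp: card_gt_0_iff)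
    then show "1 / real (Suc (card (ones n v) - 1)) = 1 / real (card (ones n v))" by simp
  qed simp
  finally show ?thesis .
qed

lemma card_covering: "(\<Sum>i\<in>{1..n}. card (covering i)) \<le> card contained"
proof -
  let ?N = "{1..n}"
  let ?Y = "\<lambda>i e. {v \<in> words d n. v i = 1 \<and> M v = {e} \<and> ones n v \<subseteq> e}"
  have fc: "finite (covering i)" for i by (simp add: covering_def facet_def)
  have one: "real (card (covering i)) \<le> (\<Sum>v\<in>{v \<in> contained. v i = 1}. 1 / real (card (ones n v)))"
    if i: "i \<in> ?N" for i
  proof -
    have "real (card (covering i)) = (\<Sum>v\<in>covering i. 1)" by simp
    \<comment> \<open>The minimizers are indexed by the fixed set \<open>Pow ?N\<close> so that the
      two sums can be interchanged.\<close>
    also have "\<dots> \<le> (\<Sum>v\<in>covering i. \<Sum>e\<in>{e \<in> Pow ?N. e \<in> M v}. 1 / real (Suc (private_rank i v e)))"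
    proof (rule sum_mono)
      fix v assume v: "v \<in> covering i"
      then have vw: "v \<in> words d n" by (simp add: covering_def facet_def)
      have "card (M v) > 0" using finite_M[OF vw] M_ne[OF vw] by (simp add: card_gt_0_iff)
      then have "1 = (\<Sum>e\<in>M v. 1 / real (card (M v)))" by simp
      also have "\<dots> \<le> (\<Sum>e\<in>M v. 1 / real (Suc (private_rank i v e)))"
      proof (rule sum_mono)
        fix e assume "e \<in> M v"
        then have "private_rank i v e < card (M v)" using private_rank[OF v] by metis
        then show "1 / real (card (M v)) \<le> 1 / real (Suc (private_rank i v e))"
          by (intro divide_left_mono) auto
      qed
      also have "M v = {e \<in> Pow ?N. e \<in> M v}" using M_sub[OF vw] by auto
      finally show "1 \<le> (\<Sum>e\<in>{e \<in> Pow ?N. e \<in> M v}. 1 / real (Suc (private_rank i v e)))" .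
    qed
    also have "\<dots> = (\<Sum>e\<in>Pow ?N. \<Sum>v\<in>{v \<in> covering i. e \<in> M v}. 1 / real (Suc (private_rank i v e)))"
      using fc by (intro sum.swap_restrict) auto
    also have "\<dots> \<le> (\<Sum>e\<in>Pow ?N. \<Sum>v\<in>?Y i e. 1 / real (card (ones n v)))"
      using i by (intro sum_mono sum_private_rank_le) auto
    \<comment> \<open>The sets \<open>?Y i e\<close> are disjoint for different e because M v = {e}
      determines e.\<close>
    also have "\<dots> = (\<Sum>v\<in>(\<Union>e\<in>Pow ?N. ?Y i e). 1 / real (card (ones n v)))"
      by (intro sum.UNION_disjoint[symmetric]) auto
    also have "(\<Union>e\<in>Pow ?N. ?Y i e) = {v \<in> contained. v i = 1}"
    proof (intro set_eqI iffI)
      fix v assume "v \<in> (\<Union>e\<in>Pow ?N. ?Y i e)"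
      then show "v \<in> {v \<in> contained. v i = 1}"
        using i by (auto simp: contained_def isolated_def ones_def)
    next
      fix v assume v: "v \<in> {v \<in> contained. v i = 1}"
      then obtain e where "M v = {e}"
        by (auto simp: contained_def isolated_def card_1_singleton_iff)
      then show "v \<in> (\<Union>e\<in>Pow ?N. ?Y i e)"
        using v M_sub[of v] by (auto simp: contained_def isolated_def)
    qed
    finally show ?thesis .
  qed
  have "real (\<Sum>i\<in>?N. card (covering i)) \<le>
      (\<Sum>i\<in>?N. \<Sum>v\<in>{v \<in> contained. v i = 1}. 1 / real (card (ones n v)))"
    unfolding of_nat_sum by (rule sum_mono) (rule one)
  also have "\<dots> = (\<Sum>v\<in>contained. \<Sum>i\<in>{i \<in> ?N. v i = 1}. 1 / real (card (ones n v)))"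
    using finite_isolated by (intro sum.swap_restrict) (auto simp: contained_def)
  \<comment> \<open>Each word receives the reciprocal of its number of ones exactly once for each of
    its ones.\<close>
  also have "\<dots> = (\<Sum>v\<in>contained. 1)"
    by (intro sum.cong, simp, unfold ones_def[symmetric]) (auto simp: contained_def isolated_def)
  finally show ?thesis by (simp flip: of_nat_sum)
qed

lemma card_isolated: "n * (d - 1) ^ (n - 1) \<le> card isolated"
proof -
  have "card (facet i) = card {v \<in> facet i. \<exists>e\<in>M v. i \<notin> e} + card (covering i)" for i
  proof -
    have "facet i = {v \<in> facet i. \<exists>e\<in>M v. i \<notin> e} \<union> covering i" by (auto simp: covering_def)
    also have "card \<dots> = card {v \<in> facet i. \<exists>e\<in>M v. i \<notin> e} + card (covering i)"
      by (rule card_Un_disjoint) (auto simp: covering_def facet_def)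
    finally show ?thesis .
  qed
  then have "(\<Sum>i\<in>{1..n}. card (facet i)) \<le> card (isolated - contained) + card contained"
    using card_avoiding card_covering by (simp add: sum.distrib add_mono)
  also have "\<dots> = card isolated"
    using finite_isolated by (simp add: card_Diff_subset contained_def card_mono)
  finally show ?thesis by (simp add: card_facet)
qed

end

section \<open>The two bounds for minimizers\<close>

text \<open>Kept apart from the theorem because the second bound applies it again, with smaller
  sides and with \<open>F\<close> pulled back along a shift.\<close>

lemma card_Z1_set_ge:
  fixes F :: "(nat \<Rightarrow> nat) \<Rightarrow> nat set \<Rightarrow> 'b::linorder"
  assumes "d \<ge> 1" and "n \<ge> 1"
    and "hypergraph_on {1..n} H" and "H \<noteq> {}"
    and A: "\<And>w. w \<in> words d n \<Longrightarrow> antichain (minimizers H F w)"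
    and B: "\<And>w e S. w \<in> words d n \<Longrightarrow> private_pair (minimizers H F w) e S \<Longrightarrow>
              minus_chi n w S \<in> words d n \<Longrightarrow> minimizers H F (minus_chi n w S) = {e}"
  shows "n * (d - 1) ^ (n - 1) \<le> card (Z1_set n H d F)"
proof -
  have H: "H \<subseteq> Pow {1..n}" using assms(3) by (auto simp: hypergraph_on_def)
  then have "finite H" using finite_subset by blast
  interpret private_descent d n "minimizers H F"
  proof
    show "minimizers H F w \<noteq> {}" for w
    proof -
      have "Min (F w ` H) \<in> F w ` H" using \<open>finite H\<close> \<open>H \<noteq> {}\<close> by simp
      then obtain e where "e \<in> H" "F w e = Min (F w ` H)" by auto
      then have "e \<in> minimizers H F w" using \<open>finite H\<close> by (simp add: minimizers_def)
      then show ?thesis by auto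
    qed
  qed (use assms H in \<open>auto simp: minimizers_def\<close>)
  have "Min (w ` {1..n}) = 1 \<longleftrightarrow> ones n w \<noteq> {}" if "w \<in> words d n" for w
  proof -
    have "Min (w ` {1..n}) = 1 \<longleftrightarrow> 1 \<in> w ` {1..n} \<and> (\<forall>a\<in>w ` {1..n}. 1 \<le> a)"
      using n by (intro Min_eq_iff) auto
    also have "\<dots> \<longleftrightarrow> 1 \<in> w ` {1..n}" using words_bounds(1)[OF that] by blast
    also have "\<dots> \<longleftrightarrow> ones n w \<noteq> {}" unfolding ones_def by force
    finally show ?thesis .
  qed
  then have "isolated = Z1_set n H d F"
    by (auto simp: isolated_def Z1_set_def Z_set_def)
  then show ?thesis using card_isolated by simp
qed

theorem mainTheorem2:
  fixes d n :: nat
    and H :: "nat set set"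
    and F :: "(nat \<Rightarrow> nat) \<Rightarrow> nat set \<Rightarrow> 'b::linorder"
  assumes "d \<ge> 1" and "n \<ge> 1"
    and "hypergraph_on {1..n} H" and "H \<noteq> {}"
    and A: "\<And>w. w \<in> words d n \<Longrightarrow> antichain (minimizers H F w)"
    and B: "\<And>w e S. w \<in> words d n \<Longrightarrow> private_pair (minimizers H F w) e S \<Longrightarrow>
              minus_chi n w S \<in> words d n \<Longrightarrow> minimizers H F (minus_chi n w S) = {e}"
  shows "card (Z1_set n H d F) \<ge> n * (d - 1) ^ (n - 1) \<and>
         card (Z_set n H d F) \<ge> n * (\<Sum>j=0..d-1. j ^ (n - 1))"
proof
  show "card (Z1_set n H d F) \<ge> n * (d - 1) ^ (n - 1)"
    using assms by (rule card_Z1_set_ge)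
  \<comment> \<open>The shift by d - 1 - j identifies the words over {1..j+1} with those over
    {d-j..d}, so \<open>L j\<close> consists of words in \<open>Z_set\<close> with minimum d -
    j.\<close>
  define up where "up j w = (\<lambda>i\<in>{1..n}. w i + (d - 1 - j))" for j and w :: "nat \<Rightarrow> nat"
  define L where "L j = up j ` Z1_set n H (Suc j) (\<lambda>w. F (up j w))" for j
  have up: "up j w \<in> words d n" if "w \<in> words (Suc j) n" "j \<le> d - 1" for j w
    using that \<open>d \<ge> 1\<close> unfolding words_def up_def by (force simp: PiE_iff)
  have mini: "minimizers H (\<lambda>w. F (up j w)) w = minimizers H F (up j w)" for j w
    by (simp add: minimizers_def)
  have level: "n * j ^ (n - 1) \<le> card (L j)" if j: "j \<le> d - 1" for j
  proof -
    have inj: "inj_on (up j) (words (Suc j) n)"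
    proof (rule inj_onI)
      fix x y assume *: "x \<in> words (Suc j) n" "y \<in> words (Suc j) n" "up j x = up j y"
      show "x = y"
      proof (rule words_eqI[OF *(1,2)])
        fix i assume "i \<in> {1..n}"
        then show "x i = y i" using fun_cong[OF *(3), of i] by (simp add: up_def)
      qed
    qed
    have "n * (Suc j - 1) ^ (n - 1) \<le> card (Z1_set n H (Suc j) (\<lambda>w. F (up j w)))"
    proof (rule card_Z1_set_ge)
      fix w assume w: "w \<in> words (Suc j) n"
      show "antichain (minimizers H (\<lambda>w. F (up j w)) w)"
        unfolding mini using A up[OF w j] .
      fix e S assume p: "private_pair (minimizers H (\<lambda>w. F (up j w)) w) e S"
        and m: "minus_chi n w S \<in> words (Suc j) n"
      \<comment> \<open>The truncated subtraction commutes with the shift because the entries of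
        \<open>w\<close> are at least 1.\<close>
      have "up j (minus_chi n w S) = minus_chi n (up j w) S"
        unfolding up_def minus_chi_def using words_bounds(1)[OF w]
        by (force simp: indicator_def restrict_def)
      then show "minimizers H (\<lambda>w. F (up j w)) (minus_chi n w S) = {e}"
        using B[OF up[OF w j] p[unfolded mini]] up[OF m j] by (simp add: mini)
    qed (use assms in auto)
    moreover have "inj_on (up j) (Z1_set n H (Suc j) (\<lambda>w. F (up j w)))"
      using inj by (rule inj_on_subset) (auto simp: Z1_set_def Z_set_def)
    ultimately show ?thesis by (simp add: L_def card_image)
  qed
  have L: "L j \<subseteq> Z_set n H d F" "\<And>w. w \<in> L j \<Longrightarrow> Min (w ` {1..n}) = d - j" if j: "j \<le> d - 1" for j
  proof -
    show "L j \<subseteq> Z_set n H d F"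
      using up[OF _ j] by (auto simp: L_def Z1_set_def Z_set_def mini)
    fix w assume "w \<in> L j"
    then obtain x where x: "Min (x ` {1..n}) = 1" "w = up j x"
      by (auto simp: L_def Z1_set_def)
    have "w ` {1..n} = (\<lambda>a. a + (d - 1 - j)) ` x ` {1..n}"
      by (force simp: x(2) up_def image_image)
    then have "Min (w ` {1..n}) = Min (x ` {1..n}) + (d - 1 - j)"
      using \<open>n \<ge> 1\<close> by (simp add: mono_Min_commute[symmetric] mono_def)
    then show "Min (w ` {1..n}) = d - j" using x(1) j \<open>d \<ge> 1\<close> by simp
  qed
  have fin: "finite (Z_set n H d F)" by (simp add: Z_set_def)
  have "n * (\<Sum>j=0..d-1. j ^ (n - 1)) \<le> (\<Sum>j=0..d-1. card (L j))"
    unfolding sum_distrib_left using level by (intro sum_mono) auto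
  \<comment> \<open>Different levels are disjoint since their words have different minima.\<close>
  also have "\<dots> = card (\<Union>j\<in>{0..d-1}. L j)"
  proof (rule card_UN_disjoint[symmetric])
    show "\<forall>i\<in>{0..d-1}. \<forall>j\<in>{0..d-1}. i \<noteq> j \<longrightarrow> L i \<inter> L j = {}"
    proof (intro ballI impI)
      fix i j assume *: "i \<in> {0..d-1}" "j \<in> {0..d-1}" "i \<noteq> j"
      then have "d - i \<noteq> d - j" using \<open>d \<ge> 1\<close> by auto
      then show "L i \<inter> L j = {}" using L(2)[of i] L(2)[of j] * by force
    qed
    show "\<forall>j\<in>{0..d-1}. finite (L j)" using L(1) fin finite_subset by (metis atLeastAtMost_iff)
  qed simp
  also have "\<dots> \<le> card (Z_set n H d F)"
    using L(1) fin by (intro card_mono UN_least) auto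
  finally show "card (Z_set n H d F) \<ge> n * (\<Sum>j=0..d-1. j ^ (n - 1))" .
qed

end
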